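(* Let $\mathcal{R}$ be a commutative Frobenius ring, let $\lambda\in\mathcal{R}$ with $\lambda^{2}=1$, let $n\ge 1$, and let $R$ denote the $n\times n$ back diagonal $(0,1)$-matrix. Let $A,B,C,D$ be $n\times n$ $\lambda$-circulant matrices over $\mathcal{R}$ satisfying $$AA^{T}+BB^{T}+CC^{T}+DD^{T}=-I_{n},\qquad CD^{T}-DC^{T}=0,\qquad -ADR+BCR-CRB+DRA=0.$$ Let $\mathcal{C}$ be the linear code over $\mathcal{R}$ of length $8n$ generated by the rows of the $4n\times 8n$ matrix $$G=\left(\; I_{4n}\;\begin{array}{|cccc} A & B & CR & DR \\ -B^{T} & A^{T} & DR & -CR \\ -CR & -DR & A & B \\ -DR & CR & -B^{T} & A^{T}\end{array}\right).$$ Then $\mathcal{C}$ is a self-dual code over $\mathcal{R}$.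
   Context: A linear code of length $m$ over a commutative Frobenius ring $\mathcal{R}$ is an $\mathcal{R}$-submodule of $\mathcal{R}^{m}$. The Euclidean inner product is $\langle x,y\rangle_E=\sum_i x_iy_i$, the dual code is $\mathcal{C}^{\perp}=\{x\in\mathcal{R}^{m}\mid \langle x,y\rangle_E=0 \text{ for all } y\in\mathcal{C}\}$, and $\mathcal{C}$ is self-dual if $\mathcal{C}=\mathcal{C}^{\perp}$. For $\lambda\in\mathcal{R}$, an $n\times n$ matrix over $\mathcal{R}$ is $\lambda$-circulant if each row after the first is obtained from the previous row $(x_1,x_2,\ldots,x_n)$ as $(\lambda x_n,x_1,\ldots,x_{n-1})$; so it is determined by its first row. The back diagonal matrix $R=(r_{ij})$ of order $n$ has $r_{i,n-i+1}=1$ and $r_{ij}=0$ if $j\ne n-i+1$. $I_k$ is the $k\times k$ identity matrix and $X^T$ the transpose of $X$. *)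

theory Defs
  imports "HOL-Algebra.QuotRing" "Jordan_Normal_Form.VS_Connect"
begin

section \<open>Commutative Frobenius rings\<close>

definition artinian :: "'a ring \<Rightarrow> bool" where
  "artinian R \<longleftrightarrow>
     (\<forall>I :: nat \<Rightarrow> 'a set. (\<forall>k. ideal (I k) R \<and> I (Suc k) \<subseteq> I k) \<longrightarrow> (\<exists>N. \<forall>k\<ge>N. I k = I N))"

definition minimal_ideal :: "'a set \<Rightarrow> 'a ring \<Rightarrow> bool" where
  "minimal_ideal I R \<longleftrightarrow> ideal I R \<and> I \<noteq> {\<zero>\<^bsub>R\<^esub>} \<and>
     (\<forall>J. ideal J R \<longrightarrow> J \<subseteq> I \<longrightarrow> J = {\<zero>\<^bsub>R\<^esub>} \<or> J = I)"

text \<open>The sum of a family of ideals is the ideal generated by their union.\<close>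

definition socle :: "'a ring \<Rightarrow> 'a set" where
  "socle R = genideal R (\<Union>{I. minimal_ideal I R})"

definition jacobson_radical :: "'a ring \<Rightarrow> 'a set" where
  "jacobson_radical R = carrier R \<inter> \<Inter>{I. maximalideal I R}"

definition ideal_module :: "'a ring \<Rightarrow> 'a set \<Rightarrow> ('a, 'a) module" where
  "ideal_module R I = \<lparr>carrier = I, mult = mult R, one = one R, zero = zero R, add = add R,
     smult = mult R\<rparr>"

text \<open>The quotient by an ideal, as a module over the ring: the scalar \<open>r\<close> acts as multiplication
  by its residue class.\<close>

definition quotient_module :: "'a ring \<Rightarrow> 'a set \<Rightarrow> ('a, 'a set) module" where
  "quotient_module R I = \<lparr>carrier = carrier (R Quot I), mult = mult (R Quot I),
     one = one (R Quot I), zero = zero (R Quot I), add = add (R Quot I),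
     smult = (\<lambda>r X. (I +>\<^bsub>R\<^esub> r) \<otimes>\<^bsub>R Quot I\<^esub> X)\<rparr>"

definition module_isomorphic ::
    "'a ring \<Rightarrow> ('a, 'b) module \<Rightarrow> ('a, 'c) module \<Rightarrow> bool" where
  "module_isomorphic R M N \<longleftrightarrow> (\<exists>f \<in> LinearCombinations.module_hom R M N. bij_betw f (carrier M) (carrier N))"

text \<open>A commutative ring \<open>R\<close> is Frobenius if it is Artinian and the \<open>R\<close>-modules \<open>R / J(R)\<close> and
  \<open>Soc R\<close> are isomorphic.  No finiteness is imposed.\<close>

definition comm_frobenius_ring :: "'a ring \<Rightarrow> bool" where
  "comm_frobenius_ring R \<longleftrightarrow> cring R \<and> artinian R \<and>
     module_isomorphic R (quotient_module R (jacobson_radical R)) (ideal_module R (socle R))"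

section \<open>Linear codes\<close>

definition linear_code :: "nat \<Rightarrow> 'a :: comm_ring_1 vec set \<Rightarrow> bool" where
  "linear_code m C \<longleftrightarrow> LinearCombinations.submodule class_ring C (module_vec TYPE('a) m)"

definition dual_code :: "nat \<Rightarrow> 'a :: comm_ring_1 vec set \<Rightarrow> 'a vec set" where
  "dual_code m C = {x \<in> carrier_vec m. \<forall>y \<in> C. x \<bullet> y = 0}"

definition self_dual :: "nat \<Rightarrow> 'a :: comm_ring_1 vec set \<Rightarrow> bool" where
  "self_dual m C \<longleftrightarrow> linear_code m C \<and> C = dual_code m C"

definition code_generated_by :: "'a :: comm_ring_1 mat \<Rightarrow> 'a vec set" where
  "code_generated_by G =
     LinearCombinations.module.span class_ring (module_vec TYPE('a) (dim_col G)) (set (rows G))"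

section \<open>Matrices\<close>

definition lambda_circulant :: "'a :: comm_ring_1 \<Rightarrow> nat \<Rightarrow> 'a mat \<Rightarrow> bool" where
  "lambda_circulant l n A \<longleftrightarrow> A \<in> carrier_mat n n \<and>
     (\<forall>i. Suc i < n \<longrightarrow>
        row A (Suc i) = vec n (\<lambda>j. if j = 0 then l * row A i $ (n - 1) else row A i $ (j - 1)))"

text \<open>Indices start at 0, so the entry 1 of row \<open>i\<close> is in column \<open>n - 1 - i\<close>.\<close>

definition back_diag :: "nat \<Rightarrow> 'a :: comm_ring_1 mat" where
  "back_diag n = mat n n (\<lambda>(i, j). if j = n - 1 - i then 1 else 0)"

definition append_cols :: "'a :: zero mat \<Rightarrow> 'a mat \<Rightarrow> 'a mat" where
  "append_cols A B = four_block_mat A B (0\<^sub>m 0 (dim_col A)) (0\<^sub>m 0 (dim_col B))"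

definition gen_matrix ::
    "nat \<Rightarrow> 'a :: comm_ring_1 mat \<Rightarrow> 'a mat \<Rightarrow> 'a mat \<Rightarrow> 'a mat \<Rightarrow> 'a mat" where
  "gen_matrix n A B C D = (let R = back_diag n in
     append_cols (1\<^sub>m (4 * n))
       (four_block_mat
          (four_block_mat A B
                          (- B\<^sup>T) A\<^sup>T)
          (four_block_mat (C * R) (D * R)
                          (D * R) (- (C * R)))
          (four_block_mat (- (C * R)) (- (D * R))
                          (- (D * R)) (C * R))
          (four_block_mat A B
                          (- B\<^sup>T) A\<^sup>T)))"

end

theory Submission
  imports Defs
begin

text \<open>Write \<open>G = (I | M)\<close>. A vector \<open>(x, y)\<close> is orthogonal to the code iff \<open>x = - M y\<close>, and lies in the
  code iff \<open>y = M\<^sup>T x\<close>; the two conditions agree once \<open>M M\<^sup>T = - I\<close>, since then also \<open>M\<^sup>T M = - I\<close>.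
  Now \<open>M\<close> has the block rows \<open>(P, Q)\<close> and \<open>(- Q, P)\<close>, where \<open>Q\<close> is symmetric because \<open>C R\<close> and \<open>D R\<close>
  are, so it suffices that \<open>P P\<^sup>T + Q Q\<^sup>T = - I\<close> and \<open>Q P\<^sup>T = P Q\<^sup>T\<close>. Circulant matrices commute with
  each other and satisfy \<open>R A\<^sup>T = A R\<close>, and as \<open>\<lambda>\<^sup>2 = 1\<close> they are closed under transposition. With these
  rules the two identities reduce, block by block, to the three hypotheses.\<close>

section \<open>Circulant matrices\<close>

lemma lambda_circulant_carrier: "lambda_circulant l n A \<Longrightarrow> A \<in> carrier_mat n n"
  by (simp add: lambda_circulant_def)

text \<open>Separates the wrap-around into column 0 from the plain diagonal shift, so that later
  arguments treat the two cases entrywise.\<close>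

lemma lambda_circulant_iff:
  "lambda_circulant l n A \<longleftrightarrow> A \<in> carrier_mat n n \<and>
     (\<forall>i. Suc i < n \<longrightarrow> A $$ (Suc i, 0) = l * A $$ (i, n - 1)) \<and>
     (\<forall>i j. Suc i < n \<longrightarrow> Suc j < n \<longrightarrow> A $$ (Suc i, Suc j) = A $$ (i, j))"
  (is "?L \<longleftrightarrow> ?R")
proof (cases "A \<in> carrier_mat n n")
  case A: True
  let ?w = "\<lambda>i. vec n (\<lambda>j. if j = 0 then l * row A i $ (n - 1) else row A i $ (j - 1))"
  have "row A (Suc i) = ?w i \<longleftrightarrow>
      A $$ (Suc i, 0) = l * A $$ (i, n - 1) \<and>
      (\<forall>j. Suc j < n \<longrightarrow> A $$ (Suc i, Suc j) = A $$ (i, j))" if i: "Suc i < n" for i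
  proof -
    have "row A (Suc i) = ?w i \<longleftrightarrow> (\<forall>j < n. A $$ (Suc i, j) = ?w i $ j)"
      using A i by (auto simp: vec_eq_iff)
    also have "\<dots> \<longleftrightarrow> A $$ (Suc i, 0) = ?w i $ 0 \<and>
        (\<forall>j. Suc j < n \<longrightarrow> A $$ (Suc i, Suc j) = ?w i $ Suc j)"
      using i by (cases n) (simp_all add: All_less_Suc2)
    finally show ?thesis
      using A i by auto
  qed
  then show ?thesis
    using A by (auto simp: lambda_circulant_def)
qed (simp add: lambda_circulant_def)

lemma lambda_circulant_index:
  assumes "lambda_circulant l n A" "i < n" "j < n"
  shows "A $$ (i, j) = (if i \<le> j then A $$ (0, j - i) else l * A $$ (0, n + j - i))"
  using assms(2,3)
proof (induction i arbitrary: j)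
  case (Suc i)
  show ?case
  proof (cases j)
    case 0
    then have "A $$ (Suc i, j) = l * A $$ (i, n - 1)"
      using assms(1) Suc.prems by (simp add: lambda_circulant_iff)
    \<comment> \<open>Since \<open>i \<le> n - 1\<close>, the induction hypothesis for the last
      column contributes no factor; the only \<open>l\<close> comes from the wrap just made.\<close>
    also have "A $$ (i, n - 1) = A $$ (0, n - 1 - i)"
      using Suc.IH[of "n - 1"] Suc.prems by auto
    finally show ?thesis
      using 0 by simp
  next
    case (Suc k)
    then have "A $$ (Suc i, j) = A $$ (i, k)"
      using assms(1) Suc.prems by (simp add: lambda_circulant_iff)
    then show ?thesis
      using Suc.IH[of k] Suc.prems Suc by simp
  qed
qed simp

text \<open>Stepping down the transpose runs the wrap-around of \<open>A\<close> backwards, that is,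
  it needs the inverse of \<open>l\<close>. This inverse is \<open>l\<close> itself because
  \<open>l\<^sup>2 = 1\<close>.\<close>

lemma lambda_circulant_transpose:
  assumes A: "lambda_circulant l n A" and l: "l\<^sup>2 = 1"
  shows "lambda_circulant l n A\<^sup>T"
proof -
  note AC = lambda_circulant_carrier[OF A]
  have "A $$ (0, Suc i) = l * A $$ (n - 1, i)" if "Suc i < n" for i
  proof -
    have "A $$ (n - 1, i) = l * A $$ (0, Suc i)"
      using lambda_circulant_index[OF A, of "n - 1" i] that by auto
    then show ?thesis
      using l by (simp add: power2_eq_square flip: mult.assoc)
  qed
  then show ?thesis
    using A AC by (simp add: lambda_circulant_iff)
qed

lemma index_mult_mat_sum:
  assumes "A \<in> carrier_mat n m" "B \<in> carrier_mat m k" "i < n" "j < k"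
  shows "(A * B) $$ (i, j) = (\<Sum>t<m. A $$ (i, t) * B $$ (t, j))"
  using assms by (simp add: scalar_prod_def atLeast0LessThan)

lemmas square_mat_simps = assoc_mult_mat[of _ n n _ n _ n] mult_carrier_mat[of _ n n _ n] for n

text \<open>In the sum for row \<open>i + 1\<close> the first summand is split off, in the sum for
  row \<open>i\<close> the last one. The remaining summands match under the shift of indices, and
  the wrap-around of \<open>A\<close> puts a factor \<open>l\<close> on the first summand, which
  pairs it with the last.\<close>

lemma lambda_circulant_mult:
  assumes A: "lambda_circulant l n A" and B: "lambda_circulant l n B"
  shows "lambda_circulant l n (A * B)"
proof -
  note AC = lambda_circulant_carrier[OF A] and BC = lambda_circulant_carrier[OF B]
  note prod = index_mult_mat_sum[OF AC BC]
  have row: "(A * B) $$ (Suc i, j) =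
      l * (A $$ (i, n - 1) * B $$ (0, j)) + (\<Sum>t<n - 1. A $$ (i, t) * B $$ (Suc t, j))"
    if "Suc i < n" "j < n" for i j
  proof -
    have "(A * B) $$ (Suc i, j) = (\<Sum>t<Suc (n - 1). A $$ (Suc i, t) * B $$ (t, j))"
      using prod that by simp
    also have "\<dots> = A $$ (Suc i, 0) * B $$ (0, j) +
        (\<Sum>t<n - 1. A $$ (Suc i, Suc t) * B $$ (Suc t, j))"
      by (rule sum.lessThan_Suc_shift)
    finally show ?thesis
      using A that by (simp add: lambda_circulant_iff mult.assoc)
  qed
  have last: "(A * B) $$ (i, j) =
      A $$ (i, n - 1) * B $$ (n - 1, j) + (\<Sum>t<n - 1. A $$ (i, t) * B $$ (t, j))"
    if "i < n" "j < n" for i j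
  proof -
    have "(A * B) $$ (i, j) = (\<Sum>t<Suc (n - 1). A $$ (i, t) * B $$ (t, j))"
      using prod that by simp
    then show ?thesis
      by (simp add: add.commute)
  qed
  have "(A * B) $$ (Suc i, 0) = l * (A * B) $$ (i, n - 1)" if i: "Suc i < n" for i
  proof -
    have "B $$ (n - 1, n - 1) = B $$ (0, 0)"
      using lambda_circulant_index[OF B, of "n - 1" "n - 1"] i by auto
    moreover have "B $$ (Suc t, 0) = l * B $$ (t, n - 1)" if "t < n - 1" for t
      using B that by (simp add: lambda_circulant_iff)
    ultimately show ?thesis
      using i row[of i 0] last[of i "n - 1"]
      by (simp add: algebra_simps sum_distrib_left del: index_mult_mat(1))
  qed
  moreover have "(A * B) $$ (Suc i, Suc j) = (A * B) $$ (i, j)"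
    if i: "Suc i < n" and j: "Suc j < n" for i j
  proof -
    have "B $$ (n - 1, j) = l * B $$ (0, Suc j)"
      using lambda_circulant_index[OF B, of "n - 1" j] j by auto
    moreover have "B $$ (Suc t, Suc j) = B $$ (t, j)" if "t < n - 1" for t
      using B j that by (simp add: lambda_circulant_iff)
    ultimately show ?thesis
      using i j row[of i "Suc j"] last[of i j]
      by (simp add: algebra_simps del: index_mult_mat(1))
  qed
  ultimately show ?thesis
    using AC BC by (simp add: lambda_circulant_iff del: index_mult_mat(1))
qed

section \<open>The back diagonal matrix\<close>

lemma back_diag_carrier [simp]: "back_diag n \<in> carrier_mat n n"
  by (simp add: back_diag_def)

lemma back_diag_transpose: "(back_diag n)\<^sup>T = back_diag n"
  by (rule eq_matI) (auto simp: back_diag_def)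

lemma index_mult_back_diag:
  fixes A :: "'a :: comm_ring_1 mat"
  assumes "A \<in> carrier_mat m n" "i < m" "j < n"
  shows "(A * back_diag n) $$ (i, j) = A $$ (i, n - 1 - j)"
proof -
  have "(A * back_diag n) $$ (i, j) = (\<Sum>t<n. if t = n - 1 - j then A $$ (i, t) else 0)"
    unfolding index_mult_mat_sum[OF assms(1) back_diag_carrier assms(2,3)]
    using assms(3) by (intro sum.cong) (auto simp: back_diag_def)
  then show ?thesis
    using assms(3) by simp
qed

lemma back_diag_squared: "back_diag n * back_diag n = 1\<^sub>m n"
proof (rule eq_matI)
  fix i j assume "i < dim_row (1\<^sub>m n)" "j < dim_col (1\<^sub>m n :: 'a mat)"
  then have "i < n" "j < n"
    by simp_all
  then show "(back_diag n * back_diag n) $$ (i, j) = (1\<^sub>m n :: 'a mat) $$ (i, j)"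
    by (subst index_mult_back_diag[OF back_diag_carrier]) (auto simp: back_diag_def)
qed (simp_all add: back_diag_def)

text \<open>Entry \<open>(i, j)\<close> of \<open>A R\<close> depends only on \<open>i + j\<close>.\<close>

lemma lambda_circulant_back_diag_symmetric:
  assumes A: "lambda_circulant l n A"
  shows "(A * back_diag n)\<^sup>T = A * back_diag n"
proof (rule eq_matI)
  note AC = lambda_circulant_carrier[OF A]
  fix i j assume "i < dim_row (A * back_diag n)" "j < dim_col (A * back_diag n)"
  then have ij: "i < n" "j < n"
    using AC by (simp_all add: back_diag_def)
  have "A $$ (j, n - 1 - i) = A $$ (i, n - 1 - j)"
    using lambda_circulant_index[OF A, of j "n - 1 - i"]
      lambda_circulant_index[OF A, of i "n - 1 - j"] ij
    by (auto simp: add.commute)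
  then show "(A * back_diag n)\<^sup>T $$ (i, j) = (A * back_diag n) $$ (i, j)"
    using ij AC by (simp add: index_mult_back_diag carrier_matD[OF back_diag_carrier] del: index_mult_mat(1))
qed (use lambda_circulant_carrier[OF A] in \<open>simp_all add: back_diag_def\<close>)

text \<open>Since \<open>A * R\<close> and \<open>R\<close> are both symmetric, transposing
  \<open>A * R\<close> gives \<open>R * A\<^sup>T\<close>.\<close>

lemma back_diag_mult_transpose:
  assumes A: "lambda_circulant l n A"
  shows "back_diag n * A\<^sup>T = A * back_diag n"
  using lambda_circulant_back_diag_symmetric[OF A]
    transpose_mult[OF lambda_circulant_carrier[OF A] back_diag_carrier]
  by (simp add: back_diag_transpose)

text \<open>With \<open>R A\<^sup>T = A R\<close> for circulant \<open>A\<close>, the symmetry of \<open>A B R\<close> gives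
  \<open>A B R = R B\<^sup>T A\<^sup>T = B R A\<^sup>T = B A R\<close>, and \<open>R\<close> is invertible.\<close>

lemma lambda_circulant_commute:
  assumes A: "lambda_circulant l n A" and B: "lambda_circulant l n B"
  shows "A * B = B * A"
proof -
  let ?R = "back_diag n :: 'a mat"
  note c = lambda_circulant_carrier[OF A] lambda_circulant_carrier[OF B] back_diag_carrier
  have tc: "A\<^sup>T \<in> carrier_mat n n" "B\<^sup>T \<in> carrier_mat n n"
    using c by simp_all
  have "A * B * ?R = ?R * (A * B)\<^sup>T"
    using back_diag_mult_transpose[OF lambda_circulant_mult[OF A B]] by simp
  also have "\<dots> = ?R * B\<^sup>T * A\<^sup>T"
    using c tc by (simp add: transpose_mult[OF c(1,2)] square_mat_simps[where n = n])
  also have "\<dots> = B * (?R * A\<^sup>T)"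
    using c tc by (simp add: back_diag_mult_transpose[OF B] square_mat_simps[where n = n])
  also have "\<dots> = B * A * ?R"
    using c by (simp add: back_diag_mult_transpose[OF A] square_mat_simps[where n = n])
  finally have "A * B * ?R * ?R = B * A * ?R * ?R"
    by simp
  then show ?thesis
    using c by (simp add: square_mat_simps[where n = n] back_diag_squared)
qed

text \<open>Passing \<open>A\<^sup>T\<close> through \<open>R\<close> turns it into
  \<open>A\<close>, which then commutes with \<open>B\<close>.\<close>

lemma mult_back_diag_transpose:
  assumes A: "lambda_circulant l n A" and B: "lambda_circulant l n B"
  shows "B * back_diag n * A\<^sup>T = A * (B * back_diag n)"
proof -
  note c = lambda_circulant_carrier[OF A] lambda_circulant_carrier[OF B] back_diag_carrier
  have "A\<^sup>T \<in> carrier_mat n n"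
    using c by simp
  then have "B * back_diag n * A\<^sup>T = B * A * back_diag n"
    using c back_diag_mult_transpose[OF A] by (simp add: square_mat_simps[where n = n])
  also have "\<dots> = A * (B * back_diag n)"
    unfolding lambda_circulant_commute[OF B A] using c
    by (simp add: square_mat_simps[where n = n])
  finally show ?thesis .
qed

text \<open>Conjugation by \<open>R\<close> transposes a circulant matrix:
  \<open>R * B * R = R * R * B\<^sup>T = B\<^sup>T\<close>. This turns products such as
  \<open>C * C\<^sup>T\<close> into squares of symmetric blocks.\<close>

lemma mult_back_diag_mult_back_diag:
  assumes A: "lambda_circulant l n A" and B: "lambda_circulant l n B"
  shows "(A * back_diag n) * (B * back_diag n) = A * B\<^sup>T"
proof -
  note c = lambda_circulant_carrier[OF A] lambda_circulant_carrier[OF B] back_diag_carrier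
  have "B\<^sup>T \<in> carrier_mat n n"
    using c by simp
  then have "(A * back_diag n) * (B * back_diag n) = A * (back_diag n * back_diag n) * B\<^sup>T"
    using c by (simp add: square_mat_simps[where n = n] flip: back_diag_mult_transpose[OF B])
  then show ?thesis
    using c by (simp add: back_diag_squared)
qed

section \<open>Block matrices with \<open>M M\<^sup>T = - I\<close>\<close>

lemma uminus_four_block_mat:
  assumes "A \<in> carrier_mat nr1 nc1" "B \<in> carrier_mat nr1 nc2"
    "C \<in> carrier_mat nr2 nc1" "D \<in> carrier_mat nr2 nc2"
  shows "- four_block_mat A B C D = four_block_mat (- A) (- B) (- C) (- D)"
  by (rule eq_matI) (use assms in auto)

lemma four_block_minus_one_mat:
  "four_block_mat (- 1\<^sub>m n) (0\<^sub>m n m) (0\<^sub>m m n) (- 1\<^sub>m m) = (- 1\<^sub>m (n + m) :: 'a :: ring_1 mat)"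
  by (rule eq_matI) auto

text \<open>Both diagonal blocks of the product are \<open>P * P\<^sup>T + Q * Q\<^sup>T\<close> up
  to order, and the off-diagonal ones are the two differences of \<open>Q * P\<^sup>T\<close> and
  \<open>P * Q\<^sup>T\<close>.\<close>

lemma skew_block_mult_transpose:
  fixes P Q :: "'a :: comm_ring_1 mat"
  assumes c: "P \<in> carrier_mat m m" "Q \<in> carrier_mat m m"
    and norm: "P * P\<^sup>T + Q * Q\<^sup>T = - 1\<^sub>m m"
    and sym: "Q * P\<^sup>T = P * Q\<^sup>T"
  shows "four_block_mat P Q (- Q) P * (four_block_mat P Q (- Q) P)\<^sup>T = - 1\<^sub>m (2 * m)"
proof -
  have tc: "P\<^sup>T \<in> carrier_mat m m" "Q\<^sup>T \<in> carrier_mat m m" "- Q \<in> carrier_mat m m"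
    "- Q\<^sup>T \<in> carrier_mat m m"
    using c by simp_all
  have t: "(four_block_mat P Q (- Q) P)\<^sup>T = four_block_mat P\<^sup>T (- Q\<^sup>T) Q\<^sup>T P\<^sup>T"
    using transpose_four_block_mat[OF c tc(3) c(1)] by (simp add: transpose_uminus)
  have "Q * Q\<^sup>T + P * P\<^sup>T = - 1\<^sub>m m"
    using norm comm_add_mat[of "P * P\<^sup>T" m m "Q * Q\<^sup>T"] c by simp
  moreover have "- (P * Q\<^sup>T) + P * Q\<^sup>T = 0\<^sub>m m m"
    using c by (intro uminus_l_inv_mat) simp
  ultimately have "four_block_mat P Q (- Q) P * (four_block_mat P Q (- Q) P)\<^sup>T =
      four_block_mat (- 1\<^sub>m m) (0\<^sub>m m m) (0\<^sub>m m m) (- 1\<^sub>m m)"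
    unfolding t using mult_four_block_mat[OF c tc(3) c(1) tc(1) tc(4) tc(2) tc(1)] norm sym c tc
    by (simp del: uminus_l_inv_mat)
  then show ?thesis
    by (simp add: four_block_minus_one_mat mult_2)
qed


text \<open>Here \<open>X\<close> and \<open>Y\<close> stand for \<open>C * R\<close> and
  \<open>D * R\<close>, and the circulant structure enters only through the commutation rules. In
  \<open>P * P\<^sup>T + Q * Q\<^sup>T\<close> the diagonal blocks reduce to \<open>norm\<close> and
  the others cancel. In \<open>Q * P\<^sup>T = P * Q\<^sup>T\<close> the diagonal blocks agree by
  \<open>intertwine\<close>, and each off-diagonal block is a form of \<open>rel\<close>.\<close>

lemma quaternionic_block_orthogonal:
  fixes A B X Y :: "'a :: comm_ring_1 mat"
  assumes c: "A \<in> carrier_mat n n" "B \<in> carrier_mat n n"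
      "X \<in> carrier_mat n n" "Y \<in> carrier_mat n n"
    and sym: "X\<^sup>T = X" "Y\<^sup>T = Y"
    and comm: "A * B = B * A" "A\<^sup>T * A = A * A\<^sup>T" "B\<^sup>T * B = B * B\<^sup>T" "Y * X = X * Y"
      "A\<^sup>T * B\<^sup>T = B\<^sup>T * A\<^sup>T"
    and intertwine: "X * A\<^sup>T = A * X" "X * B\<^sup>T = B * X" "Y * A\<^sup>T = A * Y" "Y * B\<^sup>T = B * Y"
      "X * A = A\<^sup>T * X" "X * B = B\<^sup>T * X" "Y * A = A\<^sup>T * Y" "Y * B = B\<^sup>T * Y"
    and norm: "A * A\<^sup>T + B * B\<^sup>T + X * X + Y * Y = - 1\<^sub>m n"
    and rel: "- (A * Y) + B * X - X * B + Y * A = 0\<^sub>m n n"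
  defines "P \<equiv> four_block_mat A B (- B\<^sup>T) A\<^sup>T"
    and "Q \<equiv> four_block_mat X Y Y (- X)"
  shows "four_block_mat P Q (- Q) P * (four_block_mat P Q (- Q) P)\<^sup>T = - 1\<^sub>m (4 * n)"
proof -
  have tc: "A\<^sup>T \<in> carrier_mat n n" "B\<^sup>T \<in> carrier_mat n n" "- B \<in> carrier_mat n n"
    "- B\<^sup>T \<in> carrier_mat n n" "- X \<in> carrier_mat n n"
    using c by simp_all
  have PC: "P \<in> carrier_mat (2 * n) (2 * n)" and QC: "Q \<in> carrier_mat (2 * n) (2 * n)"
    unfolding P_def Q_def using c tc by (simp_all add: mult_2)
  have PT: "P\<^sup>T = four_block_mat A\<^sup>T (- B) B\<^sup>T A"
    unfolding P_def using transpose_four_block_mat[OF c(1,2) tc(4,1)]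
    by (simp add: transpose_uminus)
  have QT: "Q\<^sup>T = Q"
    unfolding Q_def using transpose_four_block_mat[OF c(3,4,4) tc(5)]
    by (simp add: transpose_uminus sym)
  note mult_norm = mult_four_block_mat[OF c(1,2) tc(4,1) tc(1,3,2) c(1)]
    mult_four_block_mat[OF c(3,4,4) tc(5) c(3,4,4) tc(5)]
  note mult_sym = mult_four_block_mat[OF c(1,2) tc(4,1) c(3,4,4) tc(5)]
    mult_four_block_mat[OF c(3,4,4) tc(5) tc(1,3,2) c(1)]
  \<comment> \<open>Read entrywise, the matrix equations become equations in the commutative ring,
    where \<open>algebra_simps\<close> can rearrange sums. The rules \<open>intertwine\<close> move
    \<open>X\<close> and \<open>Y\<close> to the right of every product.\<close>
  have entry: "(A * A\<^sup>T) $$ (i, j) + (B * B\<^sup>T) $$ (i, j) + (X * X) $$ (i, j) + (Y * Y) $$ (i, j)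
      = (if i = j then - 1 else 0)"
    "- (A * Y) $$ (i, j) + (B * X) $$ (i, j) - (B\<^sup>T * X) $$ (i, j) + (A\<^sup>T * Y) $$ (i, j) = 0"
    if "i < n" "j < n" for i j
  proof -
    show "(A * A\<^sup>T) $$ (i, j) + (B * B\<^sup>T) $$ (i, j) + (X * X) $$ (i, j) + (Y * Y) $$ (i, j)
      = (if i = j then - 1 else 0)"
      using arg_cong[OF norm, of "\<lambda>M. M $$ (i, j)"] that c by (simp del: index_mult_mat(1))
    show "- (A * Y) $$ (i, j) + (B * X) $$ (i, j) - (B\<^sup>T * X) $$ (i, j) + (A\<^sup>T * Y) $$ (i, j) = 0"
      using arg_cong[OF rel, of "\<lambda>M. M $$ (i, j)"] that c
      by (simp add: intertwine del: index_mult_mat(1))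
  qed
  have "P * P\<^sup>T + Q * Q\<^sup>T = four_block_mat (- 1\<^sub>m n) (0\<^sub>m n n) (0\<^sub>m n n) (- 1\<^sub>m n)"
    unfolding PT QT unfolding P_def Q_def mult_norm
    using c tc entry(1)
    by (intro eq_matI) (auto simp: comm algebra_simps simp del: index_mult_mat(1))
  then have norm': "P * P\<^sup>T + Q * Q\<^sup>T = - 1\<^sub>m (2 * n)"
    by (simp add: four_block_minus_one_mat mult_2)
  have sym': "Q * P\<^sup>T = P * Q\<^sup>T"
    unfolding PT QT unfolding P_def Q_def mult_sym
    using c tc entry(2)
    by (intro cong_four_block_mat eq_matI)
      (auto simp: intertwine algebra_simps simp del: index_mult_mat(1))
  show ?thesis
    using skew_block_mult_transpose[OF PC QC norm' sym'] by simp
qed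

section \<open>Codes with a generator matrix in standard form\<close>

text \<open>Taking determinants makes \<open>det A\<close> a unit with inverse \<open>det B\<close>,
  so the scaled adjugate \<open>L\<close> is a left inverse of \<open>A\<close>. It equals
  \<open>B\<close> because \<open>B = L * A * B = L\<close>.\<close>

lemma mat_mult_left_right_inverse_comm_ring:
  fixes A B :: "'a :: comm_ring_1 mat"
  assumes A: "A \<in> carrier_mat n n" and B: "B \<in> carrier_mat n n" and AB: "A * B = 1\<^sub>m n"
  shows "B * A = 1\<^sub>m n"
proof -
  have unit: "det B * det A = 1"
    using det_mult[OF A B] AB by (simp add: mult.commute)
  note adj = adj_mat[OF A]
  define L where "L = det B \<cdot>\<^sub>m adj_mat A"
  have LC: "L \<in> carrier_mat n n"
    using adj(1) by (simp add: L_def)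
  have LA: "L * A = 1\<^sub>m n"
    unfolding L_def mult_smult_assoc_mat[OF adj(1) A] adj(3)
    by (rule eq_matI) (auto simp: unit)
  have "B = L * A * B"
    using B by (simp add: LA)
  also have "\<dots> = L"
    using LC A B by (simp add: AB square_mat_simps[where n = n])
  finally show ?thesis
    using LA by simp
qed

text \<open>The span is taken over the set of rows, so the two inclusions translate between one
  coefficient per distinct row and one coefficient per row index.\<close>

lemma code_generated_by_eq:
  fixes G :: "'a :: comm_ring_1 mat"
  assumes G: "G \<in> carrier_mat k m"
  shows "code_generated_by G = {G\<^sup>T *\<^sub>v u | u. u \<in> carrier_vec k}"
proof -
  interpret vec_module "TYPE('a)" m .
  have rows: "set (rows G) \<subseteq> carrier_vec m"
    using G rows_carrier[of G] by auto
  have dim: "\<forall>w \<in> set (rows G). dim_vec w = m"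
    using rows carrier_vecD by blast
  have mat: "mat_of_cols m (rows G) = G\<^sup>T"
    using G by (metis carrier_matD(2) cols_transpose index_transpose_mat(2) mat_of_cols_cols)
  have span: "code_generated_by G = {lincomb a (set (rows G)) | a. True}"
    using finite_span[OF finite_set rows] G by (simp add: code_generated_by_def)
  show ?thesis
  proof (intro equalityI subsetI)
    fix z assume "z \<in> code_generated_by G"
    then obtain c where "z = lincomb_list c (rows G)"
      unfolding span using lincomb_as_lincomb_list[OF rows] by auto
    then have "z = G\<^sup>T *\<^sub>v vec k c"
      using lincomb_list_as_mat_mult[OF dim, of c] mat G by simp
    then show "z \<in> {G\<^sup>T *\<^sub>v u | u. u \<in> carrier_vec k}"
      using vec_carrier by blast
  next
    fix z assume "z \<in> {G\<^sup>T *\<^sub>v u | u. u \<in> carrier_vec k}"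
    then obtain u where u: "u \<in> carrier_vec k" "z = mat_of_cols m (rows G) *\<^sub>v u"
      unfolding mat by blast
    then obtain a where "z = lincomb a (set (rows G))"
      using mat_of_cols_mult_as_finsum[of u "rows G"] rows G by auto
    then show "z \<in> code_generated_by G"
      unfolding span by blast
  qed
qed

lemma linear_code_generated_by:
  fixes G :: "'a :: comm_ring_1 mat"
  assumes G: "G \<in> carrier_mat k m"
  shows "linear_code m (code_generated_by G)"
proof -
  interpret vec_module "TYPE('a)" m .
  have "set (rows G) \<subseteq> carrier_vec m"
    using G rows_carrier[of G] by auto
  then show ?thesis
    using span_is_submodule[of "set (rows G)"] G
    by (simp add: linear_code_def code_generated_by_def)
qed

lemma append_cols_transpose_mult_vec:
  fixes A B :: "'a :: comm_ring_1 mat"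
  assumes c: "A \<in> carrier_mat k m1" "B \<in> carrier_mat k m2" and u: "u \<in> carrier_vec k"
  shows "(append_cols A B)\<^sup>T *\<^sub>v u = (A\<^sup>T *\<^sub>v u) @\<^sub>v (B\<^sup>T *\<^sub>v u)"
proof (rule eq_vecI)
  fix i assume "i < dim_vec ((A\<^sup>T *\<^sub>v u) @\<^sub>v (B\<^sup>T *\<^sub>v u))"
  then have i: "i < m1 + m2"
    using c by simp
  have "col (append_cols A B) i = (if i < m1 then col A i else col B (i - m1))"
    using c i by (intro eq_vecI) (auto simp: append_cols_def)
  then show "((append_cols A B)\<^sup>T *\<^sub>v u) $ i = ((A\<^sup>T *\<^sub>v u) @\<^sub>v (B\<^sup>T *\<^sub>v u)) $ i"
    using c i by (simp add: append_cols_def)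
qed (use c in \<open>simp_all add: append_cols_def\<close>)

lemma self_dual_standard_form:
  fixes M :: "'a :: comm_ring_1 mat"
  assumes M: "M \<in> carrier_mat k k" and MMT: "M * M\<^sup>T = - 1\<^sub>m k"
  shows "self_dual (2 * k) (code_generated_by (append_cols (1\<^sub>m k) M))"
proof -
  let ?C = "code_generated_by (append_cols (1\<^sub>m k) M)"
  have MT: "M\<^sup>T \<in> carrier_mat k k"
    using M by simp
  have GC: "append_cols (1\<^sub>m k) M \<in> carrier_mat k (2 * k)"
    using M by (auto simp: append_cols_def)
  \<comment> \<open>By \<open>MMT\<close>, the matrix \<open>- M\<^sup>T\<close> is a right inverse
    of \<open>M\<close>, hence also a left inverse.\<close>
  have "- M\<^sup>T * M = 1\<^sub>m k"
    by (rule mat_mult_left_right_inverse_comm_ring[OF M]) (use M MT MMT in simp_all)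
  then have MTM: "M\<^sup>T * M = - 1\<^sub>m k"
    using M by (metis MT carrier_matD uminus_mult_left_mat uminus_uminus_mat)
  have minus_one: "- 1\<^sub>m k *\<^sub>v v = - v" if "v \<in> carrier_vec k" for v :: "'a vec"
    using that by simp
  have C: "?C = {u @\<^sub>v (M\<^sup>T *\<^sub>v u) | u. u \<in> carrier_vec k}"
    unfolding code_generated_by_eq[OF GC] setcompr_eq_image
    by (intro image_cong) (auto simp: append_cols_transpose_mult_vec[OF one_carrier_mat M])
  have pair: "(x @\<^sub>v y) \<bullet> (u @\<^sub>v (M\<^sup>T *\<^sub>v u)) = (x + M *\<^sub>v y) \<bullet> u"
    if "x \<in> carrier_vec k" "y \<in> carrier_vec k" "u \<in> carrier_vec k" for x y u :: "'a vec"
  proof -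
    have "(x @\<^sub>v y) \<bullet> (u @\<^sub>v (M\<^sup>T *\<^sub>v u)) = x \<bullet> u + y \<bullet> (M\<^sup>T *\<^sub>v u)"
      using that MT by (intro scalar_prod_append) auto
    also have "y \<bullet> (M\<^sup>T *\<^sub>v u) = (M *\<^sub>v y) \<bullet> u"
      using transpose_vec_mult_scalar[OF MT that(3,2)] by simp
    also have "x \<bullet> u + (M *\<^sub>v y) \<bullet> u = (x + M *\<^sub>v y) \<bullet> u"
      using that M by (intro add_scalar_prod_distrib[symmetric]) auto
    finally show ?thesis .
  qed
  have "?C \<subseteq> dual_code (2 * k) ?C"
  proof
    fix z assume "z \<in> ?C"
    then obtain v where v: "v \<in> carrier_vec k" "z = v @\<^sub>v (M\<^sup>T *\<^sub>v v)"
      unfolding C by blast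
    have "M *\<^sub>v (M\<^sup>T *\<^sub>v v) = - v"
      using assoc_mult_mat_vec[OF M MT v(1)] v(1) by (simp add: MMT minus_one)
    then have "v + M *\<^sub>v (M\<^sup>T *\<^sub>v v) = 0\<^sub>v k"
      using v(1) by simp
    moreover have "M\<^sup>T *\<^sub>v v \<in> carrier_vec k"
      using MT v(1) by (rule mult_mat_vec_carrier)
    ultimately show "z \<in> dual_code (2 * k) ?C"
      using v unfolding dual_code_def C by (auto simp: pair mult_2)
  qed
  moreover have "dual_code (2 * k) ?C \<subseteq> ?C"
  proof
    fix z assume z: "z \<in> dual_code (2 * k) ?C"
    define x y where "x = vec_first z k" and "y = vec_last z k"
    have xy: "x \<in> carrier_vec k" "y \<in> carrier_vec k" "z = x @\<^sub>v y"
      using z by (auto simp: x_def y_def dual_code_def mult_2)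
    have My: "M *\<^sub>v y \<in> carrier_vec k"
      using M xy(2) by (rule mult_mat_vec_carrier)
    have "(x + M *\<^sub>v y) $ i = 0" if i: "i < k" for i
    proof -
      \<comment> \<open>Testing \<open>z\<close> against the codeword of the \<open>i\<close>-th
        unit vector isolates coordinate \<open>i\<close> of
        \<open>x + M *\<^sub>v y\<close>.\<close>
      have "z \<bullet> (unit_vec k i @\<^sub>v (M\<^sup>T *\<^sub>v unit_vec k i)) = 0"
        using z unit_vec_carrier[of k i] unfolding dual_code_def C by blast
      then have "(x + M *\<^sub>v y) \<bullet> unit_vec k i = 0"
        using pair[OF xy(1,2)] xy(3) by simp
      then show ?thesis
        using xy(1) My i by (simp del: index_mult_mat_vec)
    qed
    then have "x = - (M *\<^sub>v y)"
      using xy(1) My M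
      by (intro eq_vecI) (auto simp: eq_neg_iff_add_eq_0 simp del: index_mult_mat_vec)
    then have "x = - M *\<^sub>v y"
      using M xy(2) by simp
    then have "M\<^sup>T *\<^sub>v x = (M\<^sup>T * - M) *\<^sub>v y"
      using assoc_mult_mat_vec[OF MT _ xy(2), of "- M"] M by simp
    also have "\<dots> = y"
      using M xy(2) by (simp add: MTM)
    finally show "z \<in> ?C"
      using xy unfolding C by blast
  qed
  ultimately show ?thesis
    using linear_code_generated_by[OF GC] by (auto simp: self_dual_def)
qed

section \<open>Self-duality of the code built from four circulant blocks\<close>

theorem theorem3p4:
  fixes l :: "'a :: comm_ring_1" and n :: nat and A B C D R :: "'a mat"
  assumes "comm_frobenius_ring (class_ring :: 'a ring)"
    and "l ^ 2 = 1"
    and "n \<ge> 1"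
    and "R = back_diag n"
    and "lambda_circulant l n A" "lambda_circulant l n B"
        "lambda_circulant l n C" "lambda_circulant l n D"
    and "A * A\<^sup>T + B * B\<^sup>T + C * C\<^sup>T + D * D\<^sup>T = - 1\<^sub>m n"
    and "C * D\<^sup>T - D * C\<^sup>T = 0\<^sub>m n n"
    and "- (A * D * R) + B * C * R - C * R * B + D * R * A = 0\<^sub>m n n"
  shows "self_dual (8 * n) (code_generated_by (gen_matrix n A B C D))"
proof -
  note R = assms(4) and l = assms(2)
  note A = assms(5) and B = assms(6) and C = assms(7) and D = assms(8)
  note AT = lambda_circulant_transpose[OF A l] and BT = lambda_circulant_transpose[OF B l]
  note c = lambda_circulant_carrier[OF A] lambda_circulant_carrier[OF B]
    lambda_circulant_carrier[OF C] lambda_circulant_carrier[OF D]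
  have RC: "R \<in> carrier_mat n n"
    by (simp add: R)
  have XC: "C * R \<in> carrier_mat n n" and YC: "D * R \<in> carrier_mat n n"
    using c RC by (auto intro: mult_carrier_mat)
  define P Q where "P = four_block_mat A B (- B\<^sup>T) A\<^sup>T"
    and "Q = four_block_mat (C * R) (D * R) (D * R) (- (C * R))"
  let ?M = "four_block_mat P Q (- Q) P"
  note refl = lambda_circulant_back_diag_symmetric[of l n, folded R]
    and swap = mult_back_diag_transpose[of l n, folded R]
    and sq = mult_back_diag_mult_back_diag[of l n, folded R]
  \<comment> \<open>This is \<open>swap\<close> for \<open>U\<^sup>T\<close>, which is again
    circulant because \<open>l\<^sup>2 = 1\<close>.\<close>
  have swap': "V * R * U = U\<^sup>T * (V * R)" if "lambda_circulant l n U" "lambda_circulant l n V" for U V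
    using swap[OF lambda_circulant_transpose[OF that(1) l] that(2)] by simp
  have "D * C\<^sup>T = C * D\<^sup>T"
  proof (rule eq_matI)
    fix i j assume "i < dim_row (C * D\<^sup>T)" "j < dim_col (C * D\<^sup>T)"
    then show "(D * C\<^sup>T) $$ (i, j) = (C * D\<^sup>T) $$ (i, j)"
      using arg_cong[OF assms(10), of "\<lambda>M. M $$ (i, j)"] c by (simp del: index_mult_mat(1))
  qed (use c in simp_all)
  \<comment> \<open>By \<open>sq\<close> the two sides are \<open>D * C\<^sup>T\<close> and
    \<open>C * D\<^sup>T\<close>, so the second matrix hypothesis says that the blocks of
    \<open>Q\<close> commute.\<close>
  then have comm: "(D * R) * (C * R) = (C * R) * (D * R)"
    by (simp only: sq[OF C D] sq[OF D C])
  have norm: "A * A\<^sup>T + B * B\<^sup>T + (C * R) * (C * R) + (D * R) * (D * R) = - 1\<^sub>m n"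
    using assms(9) by (simp only: sq[OF C C] sq[OF D D])
  have rel: "- (A * (D * R)) + B * (C * R) - (C * R) * B + (D * R) * A = 0\<^sub>m n n"
    using assms(11) assoc_mult_mat[OF c(1,4) RC] assoc_mult_mat[OF c(2,3) RC] by simp
  have MMT: "?M * ?M\<^sup>T = - 1\<^sub>m (4 * n)"
    unfolding P_def Q_def
    using quaternionic_block_orthogonal[OF c(1,2) XC YC refl[OF C] refl[OF D]
        lambda_circulant_commute[OF A B] lambda_circulant_commute[OF AT A]
        lambda_circulant_commute[OF BT B] comm lambda_circulant_commute[OF AT BT]
        swap[OF A C] swap[OF B C] swap[OF A D] swap[OF B D]
        swap'[OF A C] swap'[OF B C] swap'[OF A D] swap'[OF B D] norm rel] .
  \<comment> \<open>The lower left block of the generator matrix is written out with its signs; it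
    has to be recognised as \<open>- Q\<close>.\<close>
  have "- Q = four_block_mat (- (C * R)) (- (D * R)) (- (D * R)) (C * R)"
    unfolding Q_def using uminus_four_block_mat[OF XC YC YC, of "- (C * R)"] XC by simp
  then have G: "gen_matrix n A B C D = append_cols (1\<^sub>m (4 * n)) ?M"
    by (simp add: gen_matrix_def Let_def P_def Q_def R)
  have "?M \<in> carrier_mat (4 * n) (4 * n)"
  proof -
    have "P \<in> carrier_mat (n + n) (n + n)"
      unfolding P_def using c by (intro four_block_carrier_mat) simp_all
    then have "?M \<in> carrier_mat (n + n + (n + n)) (n + n + (n + n))"
      by (intro four_block_carrier_mat)
    moreover have "n + n + (n + n) = 4 * n"
      by simp
    ultimately show ?thesis
      by simp
  qed
  from self_dual_standard_form[OF this MMT] show ?thesis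
    by (simp add: G)
qed

end
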